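(* Let $N\in\mathbb{N}$, let $R\subseteq\mathbb{N}^{N+2}$ (elements written $(x_0,x_1,\ldots,x_N,n)$), and let $n\in\mathbb{N}$. (1) $n\in\vec{\forall}R$ if and only if $$\inf_{x_1}\sup_{x_2}\cdots Q_{x_N}\ \Gamma\big(1-\tfrac12\chi_{R^*};x_1,\ldots,x_N,n\big)\le\tfrac12,$$ where the quantifiers alternate starting with $\inf$ (so $Q_{x_N}$ is $\inf$ if $N$ is odd and $\sup$ if $N$ is even). (2) $n\in\vec{\exists}R$ if and only if $$\sup_{x_1}\inf_{x_2}\cdots Q_{x_N}\ \Gamma\big(\tfrac12\chi_{(\neg R)^*};x_1,\ldots,x_N,n\big)<\tfrac12,$$ where the quantifiers alternate starting with $\sup$.
   Context: All suprema and infima range over $\mathbb{N}$. For $R\subseteq\mathbb{N}^{N+2}$ with elements $(x_0,\ldots,x_N,n)$: $\neg R=\mathbb{N}^{N+2}\setminus R$; $\chi_R$ is the characteristic function of $R$; $\vec{\forall}R=\{n : \forall x_0\,\exists x_1\,\forall x_2\cdots Q x_N\ R(x_0,\ldots,x_N,n)\}$ and $\vec{\exists}R=\{n : \exists x_0\,\forall x_1\,\exists x_2\cdots Q x_N\ R(x_0,\ldots,x_N,n)\}$ (quantifiers alternating); $R^*=\{(x_0,\ldots,x_N,n) : \forall x_0'\le x_0\ \exists x_1'\le x_1\ \forall x_2'\le x_2\cdots Q x_N'\le x_N\ R(x_0',\ldots,x_N',n)\}$ (alternating bounded quantifiers starting with $\forall$). For a bounded $f:\mathbb{N}^{N+2}\to\mathbb{R}$,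 $\Gamma(f;x_1,\ldots,x_N,n)=\sum_{x_0=0}^\infty 2^{-(x_0+1)}f(x_0,x_1,\ldots,x_N,n)$. *)

theory Defs
  imports "HOL-Analysis.Analysis"
begin

text \<open>
  An element \<open>(x\<^sub>0, \<dots>, x\<^sub>N, n)\<close> of \<open>\<nat>\<^sup>N\<^sup>+\<^sup>2\<close> is the list
  \<open>[x\<^sub>0, \<dots>, x\<^sub>N, n]\<close> of length \<open>N + 2\<close>.
\<close>

definition tuples :: "nat \<Rightarrow> nat list set" where
  "tuples k = {xs. length xs = k}"

definition neg_rel :: "nat \<Rightarrow> nat list set \<Rightarrow> nat list set" where
  "neg_rel N R = tuples (N + 2) - R"

text \<open>
  \<open>all_ex k P\<close> is \<open>\<forall>y\<^sub>1. \<exists>y\<^sub>2. \<forall>y\<^sub>3. \<dots> P [y\<^sub>1, \<dots>, y\<^sub>k]\<close> and \<open>ex_all k P\<close> is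
  \<open>\<exists>y\<^sub>1. \<forall>y\<^sub>2. \<exists>y\<^sub>3. \<dots> P [y\<^sub>1, \<dots>, y\<^sub>k]\<close>.
\<close>

fun all_ex :: "nat \<Rightarrow> (nat list \<Rightarrow> bool) \<Rightarrow> bool"
  and ex_all :: "nat \<Rightarrow> (nat list \<Rightarrow> bool) \<Rightarrow> bool" where
  "all_ex 0 P = P []"
| "all_ex (Suc k) P = (\<forall>y. ex_all k (\<lambda>ys. P (y # ys)))"
| "ex_all 0 P = P []"
| "ex_all (Suc k) P = (\<exists>y. all_ex k (\<lambda>ys. P (y # ys)))"

definition vec_all :: "nat \<Rightarrow> nat list set \<Rightarrow> nat set" where
  "vec_all N R = {n. all_ex (N + 1) (\<lambda>xs. xs @ [n] \<in> R)}"

definition vec_ex :: "nat \<Rightarrow> nat list set \<Rightarrow> nat set" where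
  "vec_ex N R = {n. ex_all (N + 1) (\<lambda>xs. xs @ [n] \<in> R)}"

text \<open>The same with the i-th quantifier bounded by the i-th entry of the first argument.\<close>

fun all_ex_le :: "nat list \<Rightarrow> (nat list \<Rightarrow> bool) \<Rightarrow> bool"
  and ex_all_le :: "nat list \<Rightarrow> (nat list \<Rightarrow> bool) \<Rightarrow> bool" where
  "all_ex_le [] P = P []"
| "all_ex_le (x # xs) P = (\<forall>y\<le>x. ex_all_le xs (\<lambda>ys. P (y # ys)))"
| "ex_all_le [] P = P []"
| "ex_all_le (x # xs) P = (\<exists>y\<le>x. all_ex_le xs (\<lambda>ys. P (y # ys)))"

definition star :: "nat \<Rightarrow> nat list set \<Rightarrow> nat list set" where
  "star N R = {xs @ [n] | xs n. xs \<in> tuples (N + 1) \<and> all_ex_le xs (\<lambda>ys. ys @ [n] \<in> R)}"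

text \<open>
  \<open>inf_sup k F\<close> is \<open>inf\<^sub>y\<^sub>1 sup\<^sub>y\<^sub>2 inf\<^sub>y\<^sub>3 \<dots> F [y\<^sub>1, \<dots>, y\<^sub>k]\<close>, and dually for \<open>sup_inf\<close>.
  These are infima and suprema in the reals, so they have the intended meaning for bounded \<open>F\<close>.
\<close>

fun inf_sup :: "nat \<Rightarrow> (nat list \<Rightarrow> real) \<Rightarrow> real"
  and sup_inf :: "nat \<Rightarrow> (nat list \<Rightarrow> real) \<Rightarrow> real" where
  "inf_sup 0 F = F []"
| "inf_sup (Suc k) F = (INF y. sup_inf k (\<lambda>ys. F (y # ys)))"
| "sup_inf 0 F = F []"
| "sup_inf (Suc k) F = (SUP y. inf_sup k (\<lambda>ys. F (y # ys)))"

text \<open>The second argument is the list \<open>[x\<^sub>1, \<dots>, x\<^sub>N, n]\<close>; the series converges for bounded \<open>f\<close>.\<close>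

definition Gam :: "(nat list \<Rightarrow> real) \<Rightarrow> nat list \<Rightarrow> real" where
  "Gam f zs = (\<Sum>x0. (1 / 2) ^ (x0 + 1) * f (x0 # zs))"

end

theory Submission
  imports Defs
begin

text \<open>
  For fixed \<open>x\<^sub>1, \<dots>, x\<^sub>N, n\<close> the section of \<open>R\<^sup>*\<close> in \<open>x\<^sub>0\<close> is an initial segment of
  \<open>\<nat>\<close> of some size \<open>K \<le> \<infinity>\<close>, and the \<open>\<Gamma>\<close>-sum of its characteristic function is
  \<open>1 - 2\<^sup>-\<^sup>K\<close>. Since these values have gaps, comparing an iterated infimum and supremum with a
  threshold inside a gap amounts to evaluating alternating quantifiers, so the infimum in (1) is at
  most \<open>1/2\<close> iff \<open>\<forall>x\<^sub>0 \<exists>x\<^sub>1 \<forall>x\<^sub>2 \<dots> R\<^sup>*\<close>. Finally \<open>R\<^sup>*\<close> can be replaced by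
  \<open>R\<close>: bounded quantifiers move through alternating unbounded ones by taking maxima of finitely many
  witnesses, because \<open>R\<^sup>*\<close> is monotone with alternating directions in its arguments.
\<close>

section \<open>Alternating quantifiers\<close>

lemma not_all_ex:
  "\<not> all_ex k P \<longleftrightarrow> ex_all k (\<lambda>xs. \<not> P xs)"
  "\<not> ex_all k P \<longleftrightarrow> all_ex k (\<lambda>xs. \<not> P xs)"
  by (induction k arbitrary: P) simp_all

lemma not_all_ex_le:
  "\<not> all_ex_le xs P \<longleftrightarrow> ex_all_le xs (\<lambda>ys. \<not> P ys)"
  "\<not> ex_all_le xs P \<longleftrightarrow> all_ex_le xs (\<lambda>ys. \<not> P ys)"
  by (induction xs arbitrary: P) simp_all

lemma all_ex_mono:
  "(\<And>xs. length xs = k \<Longrightarrow> P xs \<Longrightarrow> Q xs) \<Longrightarrow> all_ex k P \<Longrightarrow> all_ex k Q"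
  "(\<And>xs. length xs = k \<Longrightarrow> P xs \<Longrightarrow> Q xs) \<Longrightarrow> ex_all k P \<Longrightarrow> ex_all k Q"
proof (induction k arbitrary: P Q)
  case (Suc k)
  {
    case 1
    have "ex_all k (\<lambda>xs. Q (y # xs))" for y
      by (rule Suc.IH(2)[OF 1(1) 1(2)[unfolded all_ex.simps, rule_format, of y]]) simp_all
    then show ?case by simp
  next
    case 2
    from 2(2) obtain y where y: "all_ex k (\<lambda>xs. P (y # xs))" by auto
    have "all_ex k (\<lambda>xs. Q (y # xs))"
      by (rule Suc.IH(1)[OF 2(1) y]) simp_all
    then show ?case by auto
  }
qed simp_all

text \<open>The length restriction makes \<open>xs @ [n]\<close> a tuple of the right length, as
  \<open>append_in_star\<close> and \<open>neg_rel\<close> require.\<close>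

lemma all_ex_cong:
  assumes "\<And>xs. length xs = k \<Longrightarrow> P xs \<longleftrightarrow> Q xs"
  shows "all_ex k P \<longleftrightarrow> all_ex k Q" "ex_all k P \<longleftrightarrow> ex_all k Q"
  using all_ex_mono[of k P Q] all_ex_mono[of k Q P] assms by blast+

text \<open>
  Swapping the arguments in the recursive call makes the order increasing at odd and decreasing at
  even positions; these are the directions in which \<open>ex_all_le\<close> is monotone.
\<close>

inductive alt_le :: "nat list \<Rightarrow> nat list \<Rightarrow> bool" where
  Nil: "alt_le [] []"
| Cons: "x \<le> y \<Longrightarrow> alt_le ys xs \<Longrightarrow> alt_le (x # xs) (y # ys)"

lemma alt_le_refl: "alt_le xs xs"
  by (induction xs) (auto intro: alt_le.intros)

lemma all_ex_le_alt_mono: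
  "alt_le xs ys \<Longrightarrow> ex_all_le xs P \<Longrightarrow> ex_all_le ys P"
  "alt_le xs ys \<Longrightarrow> all_ex_le ys P \<Longrightarrow> all_ex_le xs P"
proof (induction xs ys arbitrary: P and P rule: alt_le.inducts)
  case (Cons x y ys xs)
  {
    case 1
    then show ?case
      using Cons.IH(2) Cons.hyps(1) by (auto intro: order_trans)
  next
    case 2
    then show ?case
      using Cons.IH(1) Cons.hyps(1) by (auto intro: order_trans)
  }
qed simp_all

text \<open>Universal quantifiers commute with the bounded one outright; for existential ones,
  monotonicity provides one witness for all y \<le> b. Peeling off a quantifier swaps the order on
  the tail, hence the reversed \<open>alt_le\<close> in the second claim.\<close>

lemma bounded_all_ex_all:
  fixes b :: nat
  shows "(\<And>y xs xs'. alt_le xs xs' \<Longrightarrow> Q y xs \<Longrightarrow> Q y xs') \<Longrightarrow>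
    ex_all k (\<lambda>xs. \<forall>y\<le>b. Q y xs) \<longleftrightarrow> (\<forall>y\<le>b. ex_all k (Q y))"
    and "(\<And>y xs xs'. alt_le xs' xs \<Longrightarrow> Q y xs \<Longrightarrow> Q y xs') \<Longrightarrow>
    all_ex k (\<lambda>xs. \<forall>y\<le>b. Q y xs) \<longleftrightarrow> (\<forall>y\<le>b. all_ex k (Q y))"
proof (induction k arbitrary: Q)
  case (Suc k)
  {
    case 1
    have swap: "all_ex k (\<lambda>xs. \<forall>y\<le>b. Q y (x # xs)) \<longleftrightarrow> (\<forall>y\<le>b. all_ex k (\<lambda>xs. Q y (x # xs)))"
      for x
      by (rule Suc.IH(2)) (auto intro: 1 alt_le.Cons)
    have "\<exists>x. \<forall>y\<le>b. all_ex k (\<lambda>xs. Q y (x # xs))" if "\<forall>y\<le>b. \<exists>x. all_ex k (\<lambda>xs. Q y (x # xs))"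
    proof -
      from that obtain g where g: "\<And>y. y \<le> b \<Longrightarrow> all_ex k (\<lambda>xs. Q y (g y # xs))"
        by metis
      \<comment> \<open>Finitely many witnesses have a maximum, and \<open>Q y\<close> survives an
        increase of the head entry.\<close>
      have "all_ex k (\<lambda>xs. Q y (Max (g ` {..b}) # xs))" if "y \<le> b" for y
      proof (rule all_ex_mono(1)[OF _ g[OF that]])
        have "g y \<le> Max (g ` {..b})"
          using \<open>y \<le> b\<close> by (intro Max_ge) auto
        then show "Q y (Max (g ` {..b}) # xs)" if "Q y (g y # xs)" for xs
          using 1[OF alt_le.Cons[OF _ alt_le_refl] that] by blast
      qed
      then show ?thesis
        by blast
    qed
    then show ?case
      by (auto simp: swap)
  next
    case 2
    have "ex_all k (\<lambda>xs. \<forall>y\<le>b. Q y (x # xs)) \<longleftrightarrow> (\<forall>y\<le>b. ex_all k (\<lambda>xs. Q y (x # xs)))" for x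
      by (rule Suc.IH(1)) (auto intro: 2 alt_le.Cons)
    then show ?case
      by auto
  }
qed simp_all

text \<open>The leading bounded quantifier is pulled out past the unbounded ones after it; the
  induction hypothesis then removes the bounds on the tail.\<close>

lemma all_ex_all_ex_le:
  "all_ex k (\<lambda>xs. all_ex_le xs P) \<longleftrightarrow> all_ex k P"
  "ex_all k (\<lambda>xs. ex_all_le xs P) \<longleftrightarrow> ex_all k P"
proof (induction k arbitrary: P)
  case (Suc k)
  have all: "all_ex (Suc k) (\<lambda>xs. all_ex_le xs P) \<longleftrightarrow> all_ex (Suc k) P" for P
  proof -
    have "ex_all k (\<lambda>xs. \<forall>y\<le>x. ex_all_le xs (\<lambda>ys. P (y # ys))) \<longleftrightarrow>
        (\<forall>y\<le>x. ex_all k (\<lambda>xs. ex_all_le xs (\<lambda>ys. P (y # ys))))" for x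
      by (rule bounded_all_ex_all(1)) (rule all_ex_le_alt_mono(1))
    \<comment> \<open>What remains is that \<forall>x. \<forall>y\<le>x amounts to \<forall>y: take
      x = y.\<close>
    then show ?thesis
      by (auto simp: Suc.IH(2))
  qed
  {
    case 1
    show ?case by (rule all)
  next
    case 2
    \<comment> \<open>By duality: the first claim for the complement of \<open>P\<close>, with both
      sides negated.\<close>
    show ?case
      using all[of "\<lambda>xs. \<not> P xs"]
      by (simp only: not_all_ex(2)[symmetric] not_all_ex_le(2)[symmetric]) blast
  }
qed simp_all

section \<open>Iterated infima and suprema of functions with a gap\<close>

text \<open>If no value is at most \<open>a\<close>, all are at least \<open>b\<close>, so the
  infimum cannot sink to \<open>a\<close> even if it is not attained. Membership of the results in
  the same set permits iteration.\<close>

lemma INF_SUP_gap: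
  fixes f :: "nat \<Rightarrow> real"
  assumes "a < b" and S: "\<And>y. f y \<in> {l..a} \<union> {b..u}"
  shows "(INF y. f y) \<in> {l..a} \<union> {b..u}" "(INF y. f y) \<le> a \<longleftrightarrow> (\<exists>y. f y \<le> a)"
    and "(SUP y. f y) \<in> {l..a} \<union> {b..u}" "(SUP y. f y) \<le> a \<longleftrightarrow> (\<forall>y. f y \<le> a)"
proof -
  \<comment> \<open>Either interval may be empty, so \<open>l\<close> alone need not be a lower
    bound, nor \<open>u\<close> an upper bound.\<close>
  have lo: "min l b \<le> f y" and up: "f y \<le> max a u" for y
    using S[of y] by auto
  have bb: "bdd_below (range f)" and ba: "bdd_above (range f)"
    using lo up by (auto intro!: bdd_belowI[of _ "min l b"] bdd_aboveI[of _ "max a u"])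
  have INF_lower: "(INF y. f y) \<le> f y" and SUP_upper: "f y \<le> (SUP y. f y)" for y
    using bb ba by (auto intro: cINF_lower cSUP_upper)
  have INF_ge: "c \<le> (INF y. f y)" if "\<And>y. c \<le> f y" for c
    using that by (auto intro: cINF_greatest)
  have SUP_le: "(SUP y. f y) \<le> c" if "\<And>y. f y \<le> c" for c
    using that by (auto intro: cSUP_least)
  have "(INF y. f y) \<in> {l..a} \<union> {b..u} \<and> ((INF y. f y) \<le> a \<longleftrightarrow> (\<exists>y. f y \<le> a))"
  proof (cases "\<exists>y. f y \<le> a")
    case True
    then obtain y where y: "f y \<le> a" by blast
    have "l \<le> f y'" for y'
      using S[of y'] S[of y] y \<open>a < b\<close> by auto
    then show ?thesis
      using y INF_lower[of y] INF_ge[of l] by auto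
  next
    case False
    then have "b \<le> f y \<and> f y \<le> u" for y
      using S[of y] by auto
    then show ?thesis
      using False INF_lower[of 0] INF_ge[of b] \<open>a < b\<close> by (auto intro: order_trans)
  qed
  then show "(INF y. f y) \<in> {l..a} \<union> {b..u}" "(INF y. f y) \<le> a \<longleftrightarrow> (\<exists>y. f y \<le> a)"
    by blast+
  have "(SUP y. f y) \<in> {l..a} \<union> {b..u} \<and> ((SUP y. f y) \<le> a \<longleftrightarrow> (\<forall>y. f y \<le> a))"
  proof (cases "\<forall>y. f y \<le> a")
    case True
    then have "l \<le> f y \<and> f y \<le> a" for y
      using S[of y] \<open>a < b\<close> by (auto dest: spec[of _ y])
    then show ?thesis
      using True SUP_upper[of 0] SUP_le[of a] by (auto intro: order_trans)
  next
    case False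
    then obtain y where y: "a < f y" by (auto simp: not_le)
    have "f y' \<le> u" for y'
      using S[of y'] S[of y] y \<open>a < b\<close> by auto
    then show ?thesis
      using y S[of y] SUP_upper[of y] SUP_le[of u] by (auto simp: not_le)
  qed
  then show "(SUP y. f y) \<in> {l..a} \<union> {b..u}" "(SUP y. f y) \<le> a \<longleftrightarrow> (\<forall>y. f y \<le> a)"
    by blast+
qed

lemma inf_sup_gap:
  assumes "a < b"
  shows "(\<And>xs. F xs \<in> {l..a} \<union> {b..u}) \<Longrightarrow>
      inf_sup k F \<in> {l..a} \<union> {b..u} \<and> (inf_sup k F \<le> a \<longleftrightarrow> ex_all k (\<lambda>xs. F xs \<le> a))"
    and "(\<And>xs. F xs \<in> {l..a} \<union> {b..u}) \<Longrightarrow>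
      sup_inf k F \<in> {l..a} \<union> {b..u} \<and> (sup_inf k F \<le> a \<longleftrightarrow> all_ex k (\<lambda>xs. F xs \<le> a))"
proof (induction k arbitrary: F)
  case (Suc k)
  {
    case 1
    note IH = Suc.IH(2)[OF 1]
    show ?case
      using INF_SUP_gap(1,2)[OF \<open>a < b\<close> IH[THEN conjunct1]] IH[THEN conjunct2]
      unfolding inf_sup.simps ex_all.simps by blast
  next
    case 2
    note IH = Suc.IH(1)[OF 2]
    show ?case
      using INF_SUP_gap(3,4)[OF \<open>a < b\<close> IH[THEN conjunct1]] IH[THEN conjunct2]
      unfolding sup_inf.simps all_ex.simps by blast
  }
qed simp_all

text \<open>The threshold 1/2 lies in no gap: the values accumulate there. The test against it is
  therefore split into tests at gap endpoints, and m becomes the outer universally quantified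
  \<open>x0\<close>.\<close>

lemma le_iff_le_add_half_powers:
  fixes s c :: real
  shows "s \<le> c \<longleftrightarrow> (\<forall>m. s \<le> c + (1 / 2) ^ (m + 2))"
proof
  assume all: "\<forall>m. s \<le> c + (1 / 2) ^ (m + 2)"
  show "s \<le> c"
  proof (rule ccontr)
    assume "\<not> s \<le> c"
    then obtain m where "(1 / 2 :: real) ^ m < s - c"
      using real_arch_pow_inv[of "s - c" "1 / 2"] by auto
    moreover have "(1 / 2 :: real) ^ (m + 2) \<le> (1 / 2) ^ m"
      by (rule power_decreasing) auto
    ultimately show False
      using all[rule_format, of m] by simp
  qed
qed (auto intro: add_increasing2)

text \<open>For the strict test a single m suffices, which yields an outer existential
  quantifier.\<close>

lemma less_iff_le_diff_half_powers:
  fixes s c :: real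
  shows "s < c \<longleftrightarrow> (\<exists>m. s \<le> c - (1 / 2) ^ (m + 1))"
proof
  assume "s < c"
  then obtain m where "(1 / 2 :: real) ^ m < c - s"
    using real_arch_pow_inv[of "c - s" "1 / 2"] by auto
  moreover have "(1 / 2 :: real) ^ (m + 1) \<le> (1 / 2) ^ m"
    by (rule power_decreasing) auto
  ultimately have "s \<le> c - (1 / 2) ^ (m + 1)"
    by linarith
  then show "\<exists>m. s \<le> c - (1 / 2) ^ (m + 1)" ..
next
  assume "\<exists>m. s \<le> c - (1 / 2) ^ (m + 1)"
  then obtain m where "s \<le> c - (1 / 2) ^ (m + 1)" ..
  then show "s < c"
    using zero_less_power[of "1 / 2 :: real" "m + 1"] by linarith
qed

section \<open>The sum over \<open>x\<^sub>0\<close>\<close>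

lemma sum_half_powers: "(\<Sum>i<m. (1 / 2) ^ (i + 1)) = 1 - (1 / 2 :: real) ^ m"
  by (induction m) auto

lemma summable_half_powers_indicat:
  "summable (\<lambda>i. (1 / 2 :: real) ^ (i + 1) * indicat_real A (i # zs))"
  by (rule summable_comparison_test'[where g = "\<lambda>i. (1 / 2) ^ i"])
    (auto simp: summable_geometric indicator_def)

lemma Gam_const_mult_indicat:
  "Gam (\<lambda>ys. c * indicat_real A ys) zs = c * Gam (indicat_real A) zs"
  using suminf_mult[OF summable_half_powers_indicat, of c A zs]
  by (simp add: Gam_def mult_ac)

lemma Gam_one_minus_indicat:
  "Gam (\<lambda>ys. 1 - c * indicat_real A ys) zs = 1 - c * Gam (indicat_real A) zs"
proof -
  have "(\<lambda>i. (1 / 2 :: real) ^ (i + 1) - c * ((1 / 2) ^ (i + 1) * indicat_real A (i # zs))) sums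
      (1 - c * Gam (indicat_real A) zs)"
    unfolding Gam_def
    using power_half_series summable_sums[OF summable_half_powers_indicat, of A zs]
    by (intro sums_diff sums_mult) simp_all
  then show ?thesis
    by (simp add: Gam_def[of "\<lambda>ys. 1 - c * indicat_real A ys"] right_diff_distrib
        mult.left_commute sums_unique[symmetric])
qed

lemma Gam_indicat_bounds:
  "0 \<le> Gam (indicat_real A) zs" "Gam (indicat_real A) zs \<le> 1"
proof -
  show "0 \<le> Gam (indicat_real A) zs"
    unfolding Gam_def by (intro suminf_nonneg summable_half_powers_indicat) auto
  have "(\<lambda>i. (1 / 2 :: real) ^ (i + 1)) sums 1"
    using power_half_series by simp
  then show "Gam (indicat_real A) zs \<le> 1"
    unfolding Gam_def
    by (intro sums_le[OF _ summable_sums[OF summable_half_powers_indicat]])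
      (auto simp: indicator_def)
qed

text \<open>If m belongs to the section, so do 0, ..., m, and their weights already give the lower
  bound; otherwise only indices below m contribute.\<close>

lemma Gam_indicat_gap:
  assumes down: "\<And>i j. j \<le> i \<Longrightarrow> i # zs \<in> A \<Longrightarrow> j # zs \<in> A"
  shows "m # zs \<in> A \<Longrightarrow> 1 - (1 / 2) ^ (m + 1) \<le> Gam (indicat_real A) zs"
    and "m # zs \<notin> A \<Longrightarrow> Gam (indicat_real A) zs \<le> 1 - (1 / 2) ^ m"
proof -
  let ?f = "\<lambda>i. (1 / 2 :: real) ^ (i + 1) * indicat_real A (i # zs)"
  show "1 - (1 / 2) ^ (m + 1) \<le> Gam (indicat_real A) zs" if "m # zs \<in> A"
  proof -
    have "1 - (1 / 2) ^ (m + 1) = (\<Sum>i<m + 1. ?f i)"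
      unfolding sum_half_powers[symmetric] using down[OF _ that] by (intro sum.cong) auto
    also have "\<dots> \<le> suminf ?f"
      by (intro sum_le_suminf summable_half_powers_indicat) auto
    finally show ?thesis by (simp add: Gam_def)
  qed
  show "Gam (indicat_real A) zs \<le> 1 - (1 / 2) ^ m" if "m # zs \<notin> A"
  proof -
    have "?f i = 0" if "i \<notin> {..<m}" for i
      using down[of m i] \<open>m # zs \<notin> A\<close> that by (auto simp: indicator_def)
    then have "suminf ?f = (\<Sum>i<m. ?f i)"
      by (intro suminf_finite) auto
    also have "\<dots> \<le> (\<Sum>i<m. (1 / 2) ^ (i + 1))"
      by (intro sum_mono) (auto simp: indicator_def)
    finally show ?thesis by (simp only: sum_half_powers Gam_def)
  qed
qed

section \<open>The relation \<open>R\<^sup>*\<close>\<close>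

lemma append_in_star:
  "xs @ [n] \<in> star N R \<longleftrightarrow> length xs = N + 1 \<and> all_ex_le xs (\<lambda>ys. ys @ [n] \<in> R)"
  by (auto simp: star_def tuples_def)

text \<open>The outermost bounded quantifier of \<open>star\<close> is universal, so lowering its
  bound only weakens the condition.\<close>

lemma star_down:
  assumes "j \<le> i" "i # zs \<in> star N R"
  shows "j # zs \<in> star N R"
proof -
  obtain xs n where "zs = xs @ [n]" "length xs = N"
    using assms(2) by (cases zs rule: rev_cases) (auto simp: star_def tuples_def)
  then show ?thesis
    using assms append_in_star[of "i # xs" n N R] append_in_star[of "j # xs" n N R] by auto
qed

lemma Gam_star_gap:
  "m # zs \<in> star N R \<Longrightarrow> 1 - (1 / 2) ^ (m + 1) \<le> Gam (indicat_real (star N R)) zs"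
  "m # zs \<notin> star N R \<Longrightarrow> Gam (indicat_real (star N R)) zs \<le> 1 - (1 / 2) ^ m"
  using Gam_indicat_gap[of zs "star N R" m] star_down[of _ _ zs N R] by blast+

lemma all_ex_star:
  "all_ex (N + 1) (\<lambda>xs. xs @ [n] \<in> star N R) \<longleftrightarrow> all_ex (N + 1) (\<lambda>xs. xs @ [n] \<in> R)"
proof -
  have "all_ex (N + 1) (\<lambda>xs. xs @ [n] \<in> star N R) \<longleftrightarrow>
      all_ex (N + 1) (\<lambda>xs. all_ex_le xs (\<lambda>ys. ys @ [n] \<in> R))"
    by (rule all_ex_cong(1)) (simp add: append_in_star)
  then show ?thesis
    by (simp only: all_ex_all_ex_le(1))
qed

lemma inf_sup_Gam_star:
  "inf_sup N (\<lambda>xs. Gam (\<lambda>ys. 1 - 1 / 2 * indicat_real (star N R) ys) (xs @ [n])) \<le> 1 / 2 \<longleftrightarrow>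
   all_ex (N + 1) (\<lambda>xs. xs @ [n] \<in> R)"
proof -
  define F where "F xs = Gam (\<lambda>ys. 1 - 1 / 2 * indicat_real (star N R) ys) (xs @ [n])" for xs
  have F: "F xs = 1 - 1 / 2 * Gam (indicat_real (star N R)) (xs @ [n])" for xs
    by (simp only: F_def Gam_one_minus_indicat)
  have "inf_sup N F \<le> 1 / 2 + (1 / 2) ^ (m + 2) \<longleftrightarrow> ex_all N (\<lambda>xs. m # xs @ [n] \<in> star N R)" for m
  proof -
    \<comment> \<open>A section of size K gives \<open>F\<close> the value 1/2 + (1/2)^(K+1); here
      \<open>a\<close> is the case K = m + 1 and \<open>b\<close> the case K = m.\<close>
    define a b :: real where "a = 1 / 2 + (1 / 2) ^ (m + 2)" and "b = 1 / 2 + (1 / 2) ^ (m + 1)"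
    have "a < b" by (simp add: a_def b_def)
    have mem: "F xs \<le> a" if "m # xs @ [n] \<in> star N R" for xs
      using Gam_star_gap(1)[OF that] by (simp add: F a_def)
    have nmem: "b \<le> F xs" if "m # xs @ [n] \<notin> star N R" for xs
      using Gam_star_gap(2)[OF that] by (simp add: F b_def)
    have "F xs \<in> {0..a} \<union> {b..1}" for xs
      using mem[of xs] nmem[of xs] Gam_indicat_bounds[of "star N R" "xs @ [n]"] by (auto simp: F)
    then have "inf_sup N F \<le> a \<longleftrightarrow> ex_all N (\<lambda>xs. F xs \<le> a)"
      using inf_sup_gap(1)[OF \<open>a < b\<close>] by blast
    moreover have "F xs \<le> a \<longleftrightarrow> m # xs @ [n] \<in> star N R" for xs
      using mem[of xs] nmem[of xs] \<open>a < b\<close> by fastforce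
    ultimately show ?thesis
      by (simp add: a_def)
  qed
  then have "inf_sup N F \<le> 1 / 2 \<longleftrightarrow> all_ex (N + 1) (\<lambda>xs. xs @ [n] \<in> star N R)"
    using le_iff_le_add_half_powers[of "inf_sup N F" "1 / 2"] by simp
  then show ?thesis
    by (simp only: all_ex_star F_def[abs_def])
qed

text \<open>Here \<open>F\<close> grows with the section, so lying below the gap means
  non-membership of m.\<close>

lemma sup_inf_Gam_star:
  "sup_inf N (\<lambda>xs. Gam (\<lambda>ys. 1 / 2 * indicat_real (star N R) ys) (xs @ [n])) < 1 / 2 \<longleftrightarrow>
   \<not> all_ex (N + 1) (\<lambda>xs. xs @ [n] \<in> R)"
proof -
  define F where "F xs = Gam (\<lambda>ys. 1 / 2 * indicat_real (star N R) ys) (xs @ [n])" for xs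
  have F: "F xs = 1 / 2 * Gam (indicat_real (star N R)) (xs @ [n])" for xs
    by (simp only: F_def Gam_const_mult_indicat)
  have "sup_inf N F \<le> 1 / 2 - (1 / 2) ^ (m + 1) \<longleftrightarrow> all_ex N (\<lambda>xs. m # xs @ [n] \<notin> star N R)" for m
  proof -
    \<comment> \<open>The values are now 1/2 - (1/2)^(K+1), with K = m for \<open>a\<close> and K =
      m + 1 for \<open>b\<close>.\<close>
    define a b :: real where "a = 1 / 2 - (1 / 2) ^ (m + 1)" and "b = 1 / 2 - (1 / 2) ^ (m + 2)"
    have "a < b" by (simp add: a_def b_def)
    have mem: "b \<le> F xs" if "m # xs @ [n] \<in> star N R" for xs
      using Gam_star_gap(1)[OF that] by (simp add: F b_def)
    have nmem: "F xs \<le> a" if "m # xs @ [n] \<notin> star N R" for xs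
      using Gam_star_gap(2)[OF that] by (simp add: F a_def)
    have "F xs \<in> {0..a} \<union> {b..1}" for xs
      using mem[of xs] nmem[of xs] Gam_indicat_bounds[of "star N R" "xs @ [n]"] by (auto simp: F)
    then have "sup_inf N F \<le> a \<longleftrightarrow> all_ex N (\<lambda>xs. F xs \<le> a)"
      using inf_sup_gap(2)[OF \<open>a < b\<close>] by blast
    moreover have "F xs \<le> a \<longleftrightarrow> m # xs @ [n] \<notin> star N R" for xs
      using mem[of xs] nmem[of xs] \<open>a < b\<close> by fastforce
    ultimately show ?thesis
      by (simp add: a_def)
  qed
  then have "sup_inf N F < 1 / 2 \<longleftrightarrow> ex_all (N + 1) (\<lambda>xs. xs @ [n] \<notin> star N R)"
    using less_iff_le_diff_half_powers[of "sup_inf N F" "1 / 2"] by simp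
  then show ?thesis
    by (simp only: not_all_ex(1)[symmetric] all_ex_star F_def[abs_def])
qed

theorem theorem3p5:
  fixes N n :: nat and R :: "nat list set"
  assumes "R \<subseteq> tuples (N + 2)"
  shows "(n \<in> vec_all N R \<longleftrightarrow>
            inf_sup N (\<lambda>xs. Gam (\<lambda>ys. 1 - 1 / 2 * indicat_real (star N R) ys) (xs @ [n])) \<le> 1 / 2)
       \<and> (n \<in> vec_ex N R \<longleftrightarrow>
            sup_inf N (\<lambda>xs. Gam (\<lambda>ys. 1 / 2 * indicat_real (star N (neg_rel N R)) ys) (xs @ [n])) < 1 / 2)"
proof -
  \<comment> \<open>On tuples of length N + 2, \<open>neg_rel\<close> is plain negation, so De
    Morgan turns the existential case into the form of \<open>sup_inf_Gam_star\<close>.\<close>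
  have "ex_all (N + 1) (\<lambda>xs. xs @ [n] \<in> R) \<longleftrightarrow>
      \<not> all_ex (N + 1) (\<lambda>xs. xs @ [n] \<in> neg_rel N R)"
    unfolding not_all_ex(1) by (rule all_ex_cong(2)) (simp add: neg_rel_def tuples_def)
  then show ?thesis
    by (simp only: inf_sup_Gam_star sup_inf_Gam_star vec_all_def vec_ex_def mem_Collect_eq)
qed

end
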